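(* Let $X,Y$ be real Banach spaces and let $H$ be a closed subspace of $L(X,Y)$ such that $X^*\otimes Y\subseteq H$. Then the norm of $H$ is non-rough if and only if the norms of $X^*$ and $Y$ are both non-rough.
   Context: All Banach spaces are real. $L(X,Y)$ is the Banach space of bounded linear operators $X\to Y$ with the operator norm, and $H$ carries this norm. $X^*\otimes Y\subseteq L(X,Y)$ is the linear span of the rank-one operators $x^*\otimes y: x\mapsto x^*(x)y$, $x^*\in X^*$, $y\in Y$. For a Banach space $Z$ and $u$ in its unit sphere $S_Z$, the roughness of $Z$ at $u$ is $$\eta(Z,u)=\limsup_{\|h\|\to 0}\frac{\|u+h\|+\|u-h\|-2}{\|h\|}.$$ For $\varepsilon>0$, the norm of $Z$ is $\varepsilon$-rough if $\eta(Z,u)\ge\varepsilon$ for every $u\in S_Z$. The norm of $Z$ is rough if it is $\varepsilon$-rough for some $\varepsilon>0$, and non-rough otherwise. *)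

theory Defs
  imports "HOL-Analysis.Analysis"
begin

text \<open>
  A Banach space \<open>Z\<close> is given as a subspace of an ambient normed space and carries the
  restricted norm; the whole type is \<open>UNIV\<close>. The upper limit is taken over nonzero \<open>h\<close> in \<open>Z\<close>
  only, and in \<^typ>\<open>ereal\<close>, where \<^const>\<open>Limsup\<close> is always meaningful (the quotient lies
  between 0 and 2 for unit vectors \<open>u\<close>).
\<close>

definition roughness :: "'z::real_normed_vector set \<Rightarrow> 'z \<Rightarrow> ereal" where
  "roughness Z u =
     Limsup (at 0 within Z) (\<lambda>h. ereal ((norm (u + h) + norm (u - h) - 2) / norm h))"

definition eps_rough_norm :: "real \<Rightarrow> 'z::real_normed_vector set \<Rightarrow> bool" where
  "eps_rough_norm \<epsilon> Z \<longleftrightarrow> (\<forall>u\<in>Z. norm u = 1 \<longrightarrow> roughness Z u \<ge> ereal \<epsilon>)"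

definition rough_norm :: "'z::real_normed_vector set \<Rightarrow> bool" where
  "rough_norm Z \<longleftrightarrow> (\<exists>\<epsilon>>0. eps_rough_norm \<epsilon> Z)"

definition rank_one ::
    "('a::real_normed_vector \<Rightarrow>\<^sub>L real) \<Rightarrow> 'b::real_normed_vector \<Rightarrow> ('a \<Rightarrow>\<^sub>L 'b)" where
  "rank_one f y = blinfun_scaleR_left y o\<^sub>L f"

lemma rank_one_apply [simp]: "blinfun_apply (rank_one f y) x = blinfun_apply f x *\<^sub>R y"
  by (simp add: rank_one_def)

definition dual_tensor :: "('a::real_normed_vector \<Rightarrow>\<^sub>L 'b::real_normed_vector) set" where
  "dual_tensor = span {rank_one f y | f y. True}"

end

theory Submission
  imports Defs
begin

text \<open>
  Along a fixed direction \<open>h\<close> the quotient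
  \<open>(\<parallel>u + t h\<parallel> + \<parallel>u - t h\<parallel> - 2) / t\<close> is nondecreasing in \<open>t > 0\<close>, because the norm is convex. So a rough
  norm can be tested on spheres of every fixed radius \<open>s\<close> instead of by an upper limit
  (\<open>rough_norm_iff\<close>). The point is that the radius then no longer depends on \<open>u\<close>, so that errors
  in approximating \<open>u\<close> can be chosen after \<open>s\<close> and kept far smaller than \<open>s\<close>.

  If \<open>Y\<close> or \<open>X\<^sup>*\<close> is rough, so is \<open>H\<close>. Given a unit vector \<open>u \<in> H\<close>, choose a unit vector \<open>x\<close> that
  almost norms \<open>u\<close>. A bad direction \<open>k \<in> Y\<close> at the normalized \<open>u x\<close> gives the bad direction
  \<open>f \<otimes> k\<close> at \<open>u\<close>, where \<open>f\<close> norms \<open>x\<close>: evaluation at \<open>x\<close> turns \<open>u \<plusminus> f \<otimes> k\<close> into \<open>u x \<plusminus> k\<close>. Dually,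
  if \<open>\<phi> \<in> Y\<^sup>*\<close> norms \<open>u x\<close>, a bad direction \<open>g \<in> X\<^sup>*\<close> at the normalized \<open>\<phi> \<circ> u\<close> gives \<open>g \<otimes> y\<close> with
  \<open>y = u x / \<parallel>u x\<parallel>\<close>, since \<open>\<phi> y = 1\<close>.

  If neither is rough, take unit vectors \<open>f \<in> X\<^sup>*\<close> and \<open>y \<in> Y\<close> of small roughness and let
  \<open>u = f \<otimes> y\<close>. Vectors \<open>x\<close> and \<open>z\<close> that almost norm \<open>u + h\<close> and \<open>u - h\<close> lie, up to sign, in a thin
  slice of the unit ball cut off by \<open>f\<close>, and small roughness at \<open>f\<close> makes such slices small
  (\<open>slice_diameter_le\<close>). Replacing \<open>h z\<close> by \<open>k = h x\<close> therefore costs little compared with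
  \<open>\<parallel>h\<parallel>\<close>, and what is left is \<open>\<parallel>f x y + k\<parallel> + \<parallel>f z y - k\<parallel>\<close>, which is at most
  \<open>\<parallel>y + k\<parallel> + \<parallel>y - k\<parallel>\<close> (\<open>norm_scaleR_add_le\<close>) and so is controlled by the roughness at \<open>y\<close>.

  The functionals \<open>f\<close> norming \<open>x\<close> and \<open>\<phi>\<close> norming \<open>u x\<close>, and those that measure the diameter of
  slices, come from the Hahn-Banach theorem (\<open>norming_functional_exists\<close>), obtained here from
  minimal sublinear functionals and Zorn's lemma.
\<close>

section \<open>Norming functionals\<close>

text \<open>
  The inequality for scaling suffices, as the equality \<open>q (c x) = c q x\<close> follows by applying
  it to \<open>inverse c\<close>; in this form both clauses pass to infima.
\<close>
definition sublinear :: "('a::real_vector \<Rightarrow> real) \<Rightarrow> bool" where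
  "sublinear q \<longleftrightarrow>
     (\<forall>x y. q (x + y) \<le> q x + q y) \<and> (\<forall>c>0. \<forall>x. q (c *\<^sub>R x) \<le> c * q x)"

lemma sublinear_add: "sublinear q \<Longrightarrow> q (x + y) \<le> q x + q y"
  by (simp add: sublinear_def)

lemma sublinear_scale:
  assumes "sublinear q" "c > 0"
  shows "q (c *\<^sub>R x) = c * q x"
proof (rule antisym)
  show "q (c *\<^sub>R x) \<le> c * q x"
    using assms by (simp add: sublinear_def)
  have "q (inverse c *\<^sub>R (c *\<^sub>R x)) \<le> inverse c * q (c *\<^sub>R x)"
    using assms unfolding sublinear_def by (meson positive_imp_inverse_positive)
  then show "c * q x \<le> q (c *\<^sub>R x)"
    using assms(2) by (simp add: field_simps)
qed

lemma sublinear_zero: "sublinear q \<Longrightarrow> q 0 = 0"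
  using sublinear_scale[of q 2 0] by simp

lemma sublinear_minus: "sublinear q \<Longrightarrow> - q (- x) \<le> q x"
  using sublinear_add[of q x "- x"] sublinear_zero[of q] by simp

text \<open>
  Infima of sublinear functionals need not be sublinear. The two witness conditions, which let
  the index vary with the operation, hold both for chains of sublinear functionals and for the
  infimum in \<open>linearize_at\<close> below, whose members need not be sublinear.
\<close>
lemma sublinear_INF:
  assumes ne: "I \<noteq> {}"
    and bdd: "\<And>x. bdd_below ((\<lambda>i. r i x) ` I)"
    and add: "\<And>i j x y. i \<in> I \<Longrightarrow> j \<in> I \<Longrightarrow> \<exists>k\<in>I. r k (x + y) \<le> r i x + r j y"
    and scale: "\<And>i c x. i \<in> I \<Longrightarrow> c > 0 \<Longrightarrow> \<exists>k\<in>I. r k (c *\<^sub>R x) \<le> c * r i x"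
  shows "sublinear (\<lambda>x. INF i\<in>I. r i x)"
  unfolding sublinear_def
proof (intro conjI allI impI)
  fix x y
  have *: "(INF k\<in>I. r k (x + y)) \<le> r i x + r j y" if ij: "i \<in> I" "j \<in> I" for i j
  proof -
    obtain k where "k \<in> I" "r k (x + y) \<le> r i x + r j y"
      using add[OF ij] by blast
    then show ?thesis
      using cINF_lower[OF bdd] by (meson order_trans)
  qed
  have "(INF k\<in>I. r k (x + y)) - r i x \<le> (INF j\<in>I. r j y)" if "i \<in> I" for i
    by (rule cINF_greatest[OF ne]) (use *[OF that] in force)
  then have "(INF k\<in>I. r k (x + y)) - (INF j\<in>I. r j y) \<le> (INF i\<in>I. r i x)"
    by (intro cINF_greatest[OF ne]) force
  then show "(INF i\<in>I. r i (x + y)) \<le> (INF i\<in>I. r i x) + (INF i\<in>I. r i y)"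
    by simp
next
  fix c :: real and x assume c: "c > 0"
  have *: "(INF k\<in>I. r k (c *\<^sub>R x)) \<le> c * r i x" if i: "i \<in> I" for i
  proof -
    obtain k where "k \<in> I" "r k (c *\<^sub>R x) \<le> c * r i x"
      using scale[OF i c] by blast
    then show ?thesis
      using cINF_lower[OF bdd] by (meson order_trans)
  qed
  have "(INF k\<in>I. r k (c *\<^sub>R x)) / c \<le> (INF i\<in>I. r i x)"
    by (rule cINF_greatest[OF ne]) (use * c in \<open>simp add: field_simps\<close>)
  then show "(INF i\<in>I. r i (c *\<^sub>R x)) \<le> c * (INF i\<in>I. r i x)"
    using c by (simp add: field_simps)
qed

text \<open>
  A sublinear functional below \<open>q\<close> (take \<open>t = 0\<close>) that is linear along \<open>y\<close>: taking \<open>t = 1\<close> at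
  \<open>x = -y\<close> gives a value at most \<open>-q y\<close>, the least that sublinearity allows there.
\<close>
definition linearize_at :: "('a::real_vector \<Rightarrow> real) \<Rightarrow> 'a \<Rightarrow> 'a \<Rightarrow> real" where
  "linearize_at q y x = (INF t\<in>{0..}. q (x + t *\<^sub>R y) - t * q y)"

lemma linearize_at:
  assumes q: "sublinear q"
  shows sublinear_linearize_at: "sublinear (linearize_at q y)"
    and linearize_at_le: "t \<ge> 0 \<Longrightarrow> linearize_at q y x \<le> q (x + t *\<^sub>R y) - t * q y"
proof -
  have bdd: "bdd_below ((\<lambda>t. q (x + t *\<^sub>R y) - t * q y) ` {0..})" for x
  proof (rule bdd_belowI2)
    fix t :: real assume "t \<in> {0..}"
    then have "t * q y = q (t *\<^sub>R y)"
      using sublinear_scale[OF q, of t y] sublinear_zero[OF q] by (cases "t = 0") auto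
    then show "- q (- x) \<le> q (x + t *\<^sub>R y) - t * q y"
      using sublinear_add[OF q, of "- x" "x + t *\<^sub>R y"] by simp
  qed
  show "t \<ge> 0 \<Longrightarrow> linearize_at q y x \<le> q (x + t *\<^sub>R y) - t * q y"
    unfolding linearize_at_def by (rule cINF_lower[OF bdd]) simp
  show "sublinear (linearize_at q y)"
    unfolding linearize_at_def
  proof (rule sublinear_INF[OF _ bdd])
    fix s t :: real and x z assume "s \<in> {0..}" "t \<in> {0..}"
    moreover have "q (x + z + (s + t) *\<^sub>R y) - (s + t) * q y
        \<le> (q (x + s *\<^sub>R y) - s * q y) + (q (z + t *\<^sub>R y) - t * q y)"
      using sublinear_add[OF q, of "x + s *\<^sub>R y" "z + t *\<^sub>R y"] by (simp add: algebra_simps)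
    ultimately show "\<exists>k\<in>{0..}. q (x + z + k *\<^sub>R y) - k * q y
        \<le> (q (x + s *\<^sub>R y) - s * q y) + (q (z + t *\<^sub>R y) - t * q y)"
      by (intro bexI[of _ "s + t"]) auto
  next
    fix t c :: real and x assume "t \<in> {0..}" and c: "c > 0"
    moreover have "q (c *\<^sub>R x + (c * t) *\<^sub>R y) - (c * t) * q y
        \<le> c * (q (x + t *\<^sub>R y) - t * q y)"
      using sublinear_scale[OF q c, of "x + t *\<^sub>R y"] by (simp add: algebra_simps)
    ultimately show "\<exists>k\<in>{0..}. q (c *\<^sub>R x + k *\<^sub>R y) - k * q y
        \<le> c * (q (x + t *\<^sub>R y) - t * q y)"
      by (intro bexI[of _ "c * t"]) auto
  qed auto
qed

lemma minimal_sublinear_exists: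
  fixes p :: "'a::real_vector \<Rightarrow> real"
  assumes p: "sublinear p"
  shows "\<exists>m. sublinear m \<and> m \<le> p \<and> (\<forall>q. sublinear q \<longrightarrow> q \<le> m \<longrightarrow> q = m)"
proof -
  define A where "A = {q. sublinear q \<and> q \<le> p}"
  define P :: "('a \<Rightarrow> real) \<Rightarrow> ('a \<Rightarrow> real) \<Rightarrow> bool" where "P = (\<lambda>a b. b \<le> a)"
  have "\<exists>m\<in>A. \<forall>a\<in>A. P m a \<longrightarrow> a = m"
  proof (rule predicate_Zorn)
    show "partial_order_on A (relation_of P A)"
      by (rule partial_order_on_relation_ofI) (auto simp: P_def)
  next
    fix C assume "C \<in> Chains (relation_of P A)"
    then have CA: "C \<subseteq> A" and chain: "\<And>a b. a \<in> C \<Longrightarrow> b \<in> C \<Longrightarrow> a \<le> b \<or> b \<le> a"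
      by (auto simp: Chains_def relation_of_def P_def)
    show "\<exists>u\<in>A. \<forall>a\<in>C. P a u"
    proof (cases "C = {}")
      case True
      then show ?thesis using p by (auto simp: A_def)
    next
      case ne: False
      have bdd: "bdd_below ((\<lambda>q. q x) ` C)" for x
      proof (rule bdd_belowI2)
        fix q assume "q \<in> C"
        then have "sublinear q" "q (- x) \<le> p (- x)"
          using CA by (auto simp: A_def le_fun_def)
        then show "- p (- x) \<le> q x"
          using sublinear_minus[of q x] by linarith
      qed
      let ?u = "\<lambda>x. INF q\<in>C. q x"
      have "sublinear ?u"
      proof (rule sublinear_INF[OF ne bdd])
        fix a b :: "'a \<Rightarrow> real" and x y assume ab: "a \<in> C" "b \<in> C"
        then obtain q where q: "q \<in> C" "q \<le> a" "q \<le> b"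
          using chain[OF ab] by blast
        then have "q (x + y) \<le> q x + q y"
          using CA by (auto simp: A_def intro: sublinear_add)
        also have "\<dots> \<le> a x + b y"
          using q by (intro add_mono) (auto simp: le_fun_def)
        finally show "\<exists>q\<in>C. q (x + y) \<le> a x + b y"
          using q by blast
      next
        fix a :: "'a \<Rightarrow> real" and c :: real and x assume "a \<in> C" "c > 0"
        then show "\<exists>q\<in>C. q (c *\<^sub>R x) \<le> c * a x"
          using CA by (intro bexI[of _ a]) (auto simp: A_def sublinear_scale subset_iff)
      qed
      moreover have lower: "?u \<le> a" if "a \<in> C" for a
        unfolding le_fun_def using cINF_lower[OF bdd that] by simp
      moreover have "?u \<le> p"
        using ne CA lower by (auto simp: A_def intro: order_trans)
      ultimately show ?thesis
        unfolding A_def P_def by blast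
    qed
  qed
  then show ?thesis
    unfolding A_def P_def by (auto intro: order_trans)
qed

text \<open>
  By minimality, linearizing \<open>m\<close> at any \<open>y\<close> changes nothing, so \<open>m x \<le> m (x + y) - m y\<close>; this is
  the superadditivity that a sublinear functional lacks.
\<close>
lemma minimal_sublinear_imp_linear:
  fixes m :: "'a::real_vector \<Rightarrow> real"
  assumes m: "sublinear m" and minimal: "\<And>q. sublinear q \<Longrightarrow> q \<le> m \<Longrightarrow> q = m"
  shows "linear m"
proof -
  have "linearize_at m y = m" for y
    using linearize_at_le[OF m, of 0]
    by (intro minimal sublinear_linearize_at[OF m]) (simp add: le_fun_def)
  then have "m x \<le> m (x + y) - m y" for x y
    using linearize_at_le[OF m, of 1 y x] by simp
  then have add: "m (x + y) = m x + m y" for x y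
    using sublinear_add[OF m, of x y] by (simp add: antisym le_diff_eq)
  have minus: "m (- x) = - m x" for x
    using add[of x "- x"] sublinear_zero[OF m] by simp
  have "m (c *\<^sub>R x) = c * m x" for c x
  proof (cases "c < 0")
    case True
    then show ?thesis
      using sublinear_scale[OF m, of "- c" x] minus[of "c *\<^sub>R x"] by simp
  next
    case False
    then show ?thesis
      using sublinear_scale[OF m, of c x] sublinear_zero[OF m] by (cases "c = 0") auto
  qed
  then show ?thesis
    using add by (intro linearI) auto
qed

text \<open>
  A minimal sublinear functional below the norm is linear and of norm at most one, but need not
  norm \<open>x0\<close>. Starting instead from the norm linearized at \<open>x0\<close> forces the value at \<open>-x0\<close>, hence
  by linearity at \<open>x0\<close>.
\<close>
lemma norming_functional_exists:
  fixes x0 :: "'a::real_normed_vector"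
  shows "\<exists>f :: 'a \<Rightarrow>\<^sub>L real. norm f \<le> 1 \<and> blinfun_apply f x0 = norm x0"
proof -
  have norm: "sublinear (norm :: 'a \<Rightarrow> real)"
    by (auto simp: sublinear_def norm_triangle_ineq)
  obtain m where m: "sublinear m" and le: "m \<le> linearize_at norm x0"
    and minimal: "\<And>q. sublinear q \<Longrightarrow> q \<le> m \<Longrightarrow> q = m"
    using minimal_sublinear_exists[OF sublinear_linearize_at[OF norm, of x0]] by blast
  interpret linear m
    by (rule minimal_sublinear_imp_linear[OF m minimal])
  have *: "m x \<le> norm (x + t *\<^sub>R x0) - t * norm x0" if "t \<ge> 0" for t x
    using le linearize_at_le[OF norm that, of x0 x] by (auto simp: le_fun_def intro: order_trans)
  have upper: "m x \<le> norm x" for x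
    using *[of 0 x] by simp
  have bound: "\<bar>m x\<bar> \<le> norm x" for x
    using upper[of x] upper[of "- x"] by (simp add: neg)
  have "bounded_linear m"
    by (rule bounded_linear_intro[of m 1]) (auto simp: add scale bound)
  then have m_apply: "blinfun_apply (Blinfun m) = m"
    by (rule bounded_linear_Blinfun_apply)
  have "norm (Blinfun m) \<le> 1"
    by (rule norm_blinfun_bound) (auto simp: m_apply bound)
  moreover have "m x0 = norm x0"
    using *[of 1 "- x0"] upper[of x0] by (simp add: neg)
  ultimately show ?thesis
    using m_apply by metis
qed

section \<open>Bounded operators\<close>

lemma norm_rank_one [simp]: "norm (rank_one f y) = norm f * norm y"
proof (cases "y = 0")
  case True
  then have "rank_one f y = 0"
    by (intro blinfun_eqI) simp
  then show ?thesis using True by simp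
next
  case False
  show ?thesis
  proof (rule antisym)
    show "norm (rank_one f y) \<le> norm f * norm y"
    proof (rule norm_blinfun_bound)
      fix x
      show "norm (rank_one f y x) \<le> norm f * norm y * norm x"
        using mult_right_mono[OF norm_blinfun[of f x], of "norm y"] by (simp add: algebra_simps)
    qed simp
    have "norm f \<le> norm (rank_one f y) / norm y"
    proof (rule norm_blinfun_bound)
      fix x
      show "norm (f x) \<le> norm (rank_one f y) / norm y * norm x"
        using norm_blinfun[of "rank_one f y" x] False by (simp add: field_simps)
    qed simp
    then show "norm f * norm y \<le> norm (rank_one f y)"
      using False by (simp add: field_simps)
  qed
qed

lemma blinfun_norm_approx:
  fixes T :: "'a::real_normed_vector \<Rightarrow>\<^sub>L 'b::real_normed_vector"
  assumes "0 \<le> c" "c < norm T"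
  shows "\<exists>x. norm x = 1 \<and> c < norm (T x)"
proof (rule ccontr)
  assume "\<nexists>x. norm x = 1 \<and> c < norm (T x)"
  then have *: "norm (T x) \<le> c" if "norm x = 1" for x
    using that by (meson not_less)
  have "norm (T x) \<le> c * norm x" for x
  proof (cases "x = 0")
    case False
    then have "norm (T (inverse (norm x) *\<^sub>R x)) \<le> c"
      by (intro *) simp
    then show ?thesis
      using False by (simp add: blinfun.scaleR_right field_simps)
  qed simp
  then have "norm T \<le> c"
    using assms by (intro norm_blinfun_bound)
  then show False using assms by simp
qed

lemma norm_le_if_functionals_le:
  fixes x :: "'a::real_normed_vector"
  assumes "\<And>g :: 'a \<Rightarrow>\<^sub>L real. norm g = 1 \<Longrightarrow> blinfun_apply g x \<le> c" and "0 \<le> c"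
  shows "norm x \<le> c"
proof (cases "x = 0")
  case False
  obtain g :: "'a \<Rightarrow>\<^sub>L real" where g: "norm g \<le> 1" "g x = norm x"
    using norming_functional_exists by blast
  have "norm x \<le> norm g * norm x"
    using norm_blinfun[of g x] g by simp
  then have "norm g = 1"
    using g False by simp
  then show ?thesis
    using assms(1)[of g] g by simp
qed (use assms in simp)

section \<open>Roughness on spheres of fixed radius\<close>

lemma norm_second_difference_scale:
  fixes u h :: "'a::real_normed_vector"
  assumes "norm u = 1" "0 \<le> t" "t \<le> 1"
  shows "norm (u + t *\<^sub>R h) + norm (u - t *\<^sub>R h) - 2 \<le> t * (norm (u + h) + norm (u - h) - 2)"
proof -
  have *: "norm (u + t *\<^sub>R k) \<le> (1 - t) + t * norm (u + k)" for k
  proof -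
    have "u + t *\<^sub>R k = (1 - t) *\<^sub>R u + t *\<^sub>R (u + k)"
      by (simp add: algebra_simps)
    then show ?thesis
      using norm_triangle_ineq[of "(1 - t) *\<^sub>R u" "t *\<^sub>R (u + k)"] assms by simp
  qed
  show ?thesis
    using *[of h] *[of "- h"] by (simp add: algebra_simps)
qed

lemma less_Limsup_imp_frequently:
  fixes X :: "'a \<Rightarrow> 'b::complete_linorder"
  assumes "c < Limsup F X"
  shows "\<exists>\<^sub>F x in F. c < X x"
  using assms Limsup_bounded[of X c F] by (auto simp: frequently_def not_less leD)

text \<open>
  An upper limit at least \<open>\<epsilon>\<close> yields directions of arbitrarily small norm whose quotient exceeds
  \<open>\<epsilon> / 2\<close>; by convexity such a direction can be stretched to any larger norm \<open>s\<close> without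
  decreasing the quotient. Conversely, small \<open>s\<close> witness the upper limit.
\<close>
lemma rough_norm_iff:
  fixes Z :: "'a::real_normed_vector set"
  assumes Z: "subspace Z"
  shows "rough_norm Z \<longleftrightarrow>
    (\<exists>\<epsilon>>0. \<forall>u\<in>Z. norm u = 1 \<longrightarrow>
       (\<forall>s>0. \<exists>h\<in>Z. norm h = s \<and> norm (u + h) + norm (u - h) \<ge> 2 + \<epsilon> * s))"
    (is "_ \<longleftrightarrow> ?R")
proof
  assume "rough_norm Z"
  then obtain \<epsilon> where "\<epsilon> > 0"
    and rough: "\<And>u. u \<in> Z \<Longrightarrow> norm u = 1 \<Longrightarrow> ereal \<epsilon> \<le> roughness Z u"
    by (auto simp: rough_norm_def eps_rough_norm_def)
  have "\<exists>h\<in>Z. norm h = s \<and> norm (u + h) + norm (u - h) \<ge> 2 + (\<epsilon> / 2) * s"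
    if u: "u \<in> Z" "norm u = 1" and s: "s > 0" for u and s :: real
  proof -
    have "ereal (\<epsilon> / 2) < roughness Z u"
      using rough[OF u] \<open>\<epsilon> > 0\<close> by (auto intro: less_le_trans[of _ "ereal \<epsilon>"])
    then have "\<exists>\<^sub>F h in at 0 within Z. ereal (\<epsilon> / 2) < ereal ((norm (u + h) + norm (u - h) - 2) / norm h)"
      unfolding roughness_def by (rule less_Limsup_imp_frequently)
    moreover have "\<forall>\<^sub>F h in at 0 within Z. h \<in> Z \<and> h \<noteq> 0 \<and> norm h < s"
      unfolding eventually_at using s by (intro exI[of _ s]) auto
    ultimately have "\<exists>\<^sub>F h in at 0 within Z. (h \<in> Z \<and> h \<noteq> 0 \<and> norm h < s) \<and>
        ereal (\<epsilon> / 2) < ereal ((norm (u + h) + norm (u - h) - 2) / norm h)"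
      by (rule frequently_eventually_conj)
    then obtain k where k: "\<epsilon> / 2 < (norm (u + k) + norm (u - k) - 2) / norm k" "k \<in> Z" "k \<noteq> 0" "norm k < s"
      by (auto dest!: frequently_ex)
    define t where "t = norm k / s"
    have t: "0 < t" "t \<le> 1" "norm k = t * s"
      using k s by (auto simp: t_def)
    define h where "h = inverse t *\<^sub>R k"
    have h: "k = t *\<^sub>R h" "norm h = s" "h \<in> Z"
      using t k Z by (auto simp: h_def subspace_scale)
    have "t * ((\<epsilon> / 2) * s) < norm (u + k) + norm (u - k) - 2"
      using k(1,3) t s by (simp add: less_divide_eq mult.commute mult.left_commute)
    also have "\<dots> \<le> t * (norm (u + h) + norm (u - h) - 2)"
      unfolding h(1) using norm_second_difference_scale[OF u(2)] t by simp
    finally have "(\<epsilon> / 2) * s \<le> norm (u + h) + norm (u - h) - 2"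
      using t(1) by simp
    then show ?thesis using h by auto
  qed
  then show ?R
    using \<open>\<epsilon> > 0\<close> by (intro exI[of _ "\<epsilon> / 2"]) auto
next
  assume ?R
  then obtain \<epsilon> where "\<epsilon> > 0"
    and rough: "\<And>u s. u \<in> Z \<Longrightarrow> norm u = 1 \<Longrightarrow> s > 0 \<Longrightarrow>
       \<exists>h\<in>Z. norm h = s \<and> norm (u + h) + norm (u - h) \<ge> 2 + \<epsilon> * s"
    by blast
  have "ereal \<epsilon> \<le> roughness Z u" if u: "u \<in> Z" "norm u = 1" for u
    unfolding roughness_def Limsup_def
  proof (rule INF_greatest, clarify)
    fix P :: "'a \<Rightarrow> bool" assume "eventually P (at 0 within Z)"
    then obtain d where d: "d > 0" "\<And>h. h \<in> Z \<Longrightarrow> h \<noteq> 0 \<Longrightarrow> norm h < d \<Longrightarrow> P h"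
      unfolding eventually_at by (auto simp: dist_norm)
    obtain h where h: "h \<in> Z" "norm h = d / 2" "norm (u + h) + norm (u - h) \<ge> 2 + \<epsilon> * (d / 2)"
      using rough[OF u, of "d / 2"] d(1) by auto
    have "P h"
      using d h by (intro d(2)) auto
    moreover have "\<epsilon> \<le> (norm (u + h) + norm (u - h) - 2) / norm h"
      unfolding h(2) using d(1) h(3) by (simp add: field_simps)
    ultimately show "ereal \<epsilon> \<le> (SUP h\<in>Collect P. ereal ((norm (u + h) + norm (u - h) - 2) / norm h))"
      by (intro SUP_upper2[of h]) auto
  qed
  then show "rough_norm Z"
    using \<open>\<epsilon> > 0\<close> by (auto simp: rough_norm_def eps_rough_norm_def)
qed

text \<open>
  Convexity extends the estimate from the sphere of radius \<open>s\<close> to the whole ball.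
\<close>
lemma non_rough_normE:
  fixes Z :: "'a::real_normed_vector set"
  assumes Z: "subspace Z" and "\<not> rough_norm Z" and "\<epsilon> > 0"
  obtains u s where "u \<in> Z" "norm u = 1" "s > 0"
    "\<And>h. h \<in> Z \<Longrightarrow> norm h \<le> s \<Longrightarrow> norm (u + h) + norm (u - h) \<le> 2 + \<epsilon> * norm h"
proof -
  obtain u s where u: "u \<in> Z" "norm u = 1" and s: "s > 0"
    and less: "\<And>h. h \<in> Z \<Longrightarrow> norm h = s \<Longrightarrow> norm (u + h) + norm (u - h) < 2 + \<epsilon> * s"
    using assms(2,3) unfolding rough_norm_iff[OF Z] by (meson not_less)
  have "norm (u + h) + norm (u - h) \<le> 2 + \<epsilon> * norm h" if h: "h \<in> Z" "norm h \<le> s" for h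
  proof (cases "h = 0")
    case False
    define t where "t = norm h / s"
    have t: "0 < t" "t \<le> 1" "norm h = t * s"
      using h s False by (auto simp: t_def)
    define k where "k = inverse t *\<^sub>R h"
    have k: "h = t *\<^sub>R k" "norm k = s" "k \<in> Z"
      using t h Z by (auto simp: k_def subspace_scale)
    have "norm (u + h) + norm (u - h) - 2 \<le> t * (norm (u + k) + norm (u - k) - 2)"
      unfolding k(1) using norm_second_difference_scale[OF u(2)] t by simp
    also have "\<dots> \<le> t * (\<epsilon> * s)"
      using less[OF k(3,2)] t by (intro mult_left_mono) auto
    finally show ?thesis
      using t(3) by (simp add: mult.left_commute)
  qed (use u in simp)
  then show thesis
    using that u s by blast
qed

section \<open>Lower bounds for the norm on a space of operators\<close>

text \<open>
  Evaluation at a unit vector \<open>x\<close> is a contraction from \<open>H\<close> to \<open>Y\<close>, so a large second difference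
  of the norm at \<open>u x\<close> forces one at \<open>u\<close>, as soon as the direction in \<open>Y\<close> lifts to an operator
  of the same norm. A rank-one operator built from a functional norming \<open>x\<close> is such a lift.
\<close>
lemma rough_operators_if_rough_codomain:
  fixes H :: "('a::real_normed_vector \<Rightarrow>\<^sub>L 'b::real_normed_vector) set"
  assumes H: "subspace H" and rank_one: "\<And>f y. rank_one f y \<in> H"
    and rough: "rough_norm (UNIV :: 'b set)"
  shows "rough_norm H"
proof -
  obtain \<epsilon> where "\<epsilon> > 0" and rough': "\<And>y s. norm (y::'b) = 1 \<Longrightarrow> s > 0 \<Longrightarrow>
      \<exists>k. norm k = s \<and> norm (y + k) + norm (y - k) \<ge> 2 + \<epsilon> * s"
    using rough unfolding rough_norm_iff[OF subspace_UNIV] by auto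
  have "\<exists>h\<in>H. norm h = s \<and> norm (u + h) + norm (u - h) \<ge> 2 + (\<epsilon> / 2) * s"
    if u: "u \<in> H" "norm u = 1" and s: "s > 0" for u and s :: real
  proof -
    \<comment> \<open>two errors of size \<open>\<tau>\<close> must cost at most half of the gain \<open>\<epsilon> * s\<close>\<close>
    define \<tau> where "\<tau> = min (1 / 2) (\<epsilon> * s / 4)"
    have \<tau>: "0 < \<tau>" "\<tau> \<le> 1 / 2" "\<tau> \<le> \<epsilon> * s / 4"
      using \<open>\<epsilon> > 0\<close> s by (auto simp: \<tau>_def)
    obtain x where x: "norm x = 1" "1 - \<tau> < norm (u x)"
      using blinfun_norm_approx[of "1 - \<tau>" u] \<tau> u by auto
    have ux: "0 < norm (u x)" "norm (u x) \<le> 1"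
      using x \<tau> norm_blinfun[of u x] u by auto
    define y where "y = inverse (norm (u x)) *\<^sub>R u x"
    have "norm y = 1"
      using ux by (simp add: y_def)
    then obtain k where k: "norm k = s" "norm (y + k) + norm (y - k) \<ge> 2 + \<epsilon> * s"
      using rough' s by blast
    have "y - u x = (1 - norm (u x)) *\<^sub>R y"
      using ux by (simp add: y_def algebra_simps)
    then have close: "norm (y - u x) \<le> \<tau>"
      using \<open>norm y = 1\<close> ux x by simp
    obtain f :: "'a \<Rightarrow>\<^sub>L real" where f: "norm f \<le> 1" "f x = norm x"
      using norming_functional_exists by blast
    have "norm f = 1"
      using f norm_blinfun[of f x] x by simp
    define h where "h = rank_one f k"
    have hx: "h x = k"
      using f x by (simp add: h_def)
    have "norm (y + k) \<le> norm (u x + k) + \<tau>"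
      using norm_triangle_ineq[of "u x + k" "y - u x"] close by (simp add: add.commute)
    moreover have "norm (y - k) \<le> norm (u x - k) + \<tau>"
      using norm_triangle_ineq[of "u x - k" "y - u x"] close by simp
    moreover have "norm (u x + k) \<le> norm (u + h)"
      using norm_blinfun[of "u + h" x] x hx by (simp add: blinfun.add_left)
    moreover have "norm (u x - k) \<le> norm (u - h)"
      using norm_blinfun[of "u - h" x] x hx by (simp add: blinfun.diff_left)
    ultimately have "norm (u + h) + norm (u - h) \<ge> 2 + (\<epsilon> / 2) * s"
      using k \<tau> by (simp add: field_simps)
    moreover have "h \<in> H" "norm h = s"
      using rank_one \<open>norm f = 1\<close> k by (auto simp: h_def)
    ultimately show ?thesis by blast
  qed
  then show ?thesis
    unfolding rough_norm_iff[OF H] using \<open>\<epsilon> > 0\<close> by (intro exI[of _ "\<epsilon> / 2"]) auto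
qed

text \<open>
  The same argument with the contraction \<open>T \<mapsto> \<phi> \<circ> T\<close> into \<open>X\<^sup>*\<close> in place of evaluation.
\<close>
lemma rough_operators_if_rough_dual_domain:
  fixes H :: "('a::real_normed_vector \<Rightarrow>\<^sub>L 'b::real_normed_vector) set"
  assumes H: "subspace H" and rank_one: "\<And>f y. rank_one f y \<in> H"
    and rough: "rough_norm (UNIV :: ('a \<Rightarrow>\<^sub>L real) set)"
  shows "rough_norm H"
proof -
  obtain \<epsilon> where "\<epsilon> > 0" and rough': "\<And>f s. norm (f :: 'a \<Rightarrow>\<^sub>L real) = 1 \<Longrightarrow> s > 0 \<Longrightarrow>
      \<exists>g. norm g = s \<and> norm (f + g) + norm (f - g) \<ge> 2 + \<epsilon> * s"
    using rough unfolding rough_norm_iff[OF subspace_UNIV] by auto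
  have "\<exists>h\<in>H. norm h = s \<and> norm (u + h) + norm (u - h) \<ge> 2 + (\<epsilon> / 2) * s"
    if u: "u \<in> H" "norm u = 1" and s: "s > 0" for u and s :: real
  proof -
    \<comment> \<open>two errors of size \<open>\<tau>\<close> must cost at most half of the gain \<open>\<epsilon> * s\<close>\<close>
    define \<tau> where "\<tau> = min (1 / 2) (\<epsilon> * s / 4)"
    have \<tau>: "0 < \<tau>" "\<tau> \<le> 1 / 2" "\<tau> \<le> \<epsilon> * s / 4"
      using \<open>\<epsilon> > 0\<close> s by (auto simp: \<tau>_def)
    obtain x where x: "norm x = 1" "1 - \<tau> < norm (u x)"
      using blinfun_norm_approx[of "1 - \<tau>" u] \<tau> u by auto
    have ux: "0 < norm (u x)"
      using x \<tau> by auto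
    obtain \<phi> :: "'b \<Rightarrow>\<^sub>L real" where \<phi>: "norm \<phi> \<le> 1" "\<phi> (u x) = norm (u x)"
      using norming_functional_exists by blast
    have adjoint_le: "norm (\<phi> o\<^sub>L T) \<le> norm T" for T :: "'a \<Rightarrow>\<^sub>L 'b"
      using norm_blinfun_compose[of \<phi> T] \<phi> by (meson mult_left_le_one_le norm_ge_zero order_trans)
    define F where "F = \<phi> o\<^sub>L u"
    have F: "1 - \<tau> < norm F" "norm F \<le> 1"
      using norm_blinfun[of F x] x \<phi> adjoint_le[of u] u by (auto simp: F_def)
    define f where "f = inverse (norm F) *\<^sub>R F"
    have "norm F \<noteq> 0"
      using F \<tau> by linarith
    then have "norm f = 1"
      by (simp add: f_def)
    then obtain g where g: "norm g = s" "norm (f + g) + norm (f - g) \<ge> 2 + \<epsilon> * s"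
      using rough' s by blast
    have "f - F = (1 - norm F) *\<^sub>R f"
      using \<open>norm F \<noteq> 0\<close> by (simp add: f_def algebra_simps)
    then have close: "norm (f - F) \<le> \<tau>"
      using \<open>norm f = 1\<close> F by simp
    define y where "y = inverse (norm (u x)) *\<^sub>R u x"
    have y: "norm y = 1" "\<phi> y = 1"
      using ux \<phi> by (auto simp: y_def blinfun.scaleR_right)
    define h where "h = rank_one g y"
    have plus: "\<phi> o\<^sub>L (u + h) = F + g" and minus: "\<phi> o\<^sub>L (u - h) = F - g"
      using y by (auto intro!: blinfun_eqI
          simp: F_def h_def blinfun.add_left blinfun.diff_left blinfun.add_right blinfun.diff_right blinfun.scaleR_right)
    have "norm (f + g) \<le> norm (F + g) + \<tau>"
      using norm_triangle_ineq[of "F + g" "f - F"] close by (simp add: add.commute)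
    moreover have "norm (f - g) \<le> norm (F - g) + \<tau>"
      using norm_triangle_ineq[of "F - g" "f - F"] close by simp
    moreover have "norm (F + g) \<le> norm (u + h)" "norm (F - g) \<le> norm (u - h)"
      using adjoint_le[of "u + h"] adjoint_le[of "u - h"] by (simp_all add: plus minus)
    ultimately have "norm (u + h) + norm (u - h) \<ge> 2 + (\<epsilon> / 2) * s"
      using g \<tau> by (simp add: field_simps)
    moreover have "h \<in> H" "norm h = s"
      using rank_one y g by (auto simp: h_def)
    ultimately show ?thesis by blast
  qed
  then show ?thesis
    unfolding rough_norm_iff[OF H] using \<open>\<epsilon> > 0\<close> by (intro exI[of _ "\<epsilon> / 2"]) auto
qed

section \<open>Upper bounds at a rank-one operator\<close>

text \<open>
  One half of Smulian's duality between smoothness and small slices: test \<open>f + s g\<close> at \<open>x\<close> and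
  \<open>f - s g\<close> at \<open>z\<close>. As \<open>f x + f z\<close> is almost 2, the excess of the sum of the two norms over 2
  almost bounds \<open>s * g (x - z)\<close>.
\<close>
lemma slice_diameter_le:
  fixes f :: "'a::real_normed_vector \<Rightarrow>\<^sub>L real"
  assumes smooth: "\<And>g. norm g \<le> s \<Longrightarrow> norm (f + g) + norm (f - g) \<le> 2 + \<epsilon> * norm g"
    and "s > 0" "\<epsilon> \<ge> 0" "\<delta> \<ge> 0"
    and x: "norm x \<le> 1" "1 - \<delta> \<le> f x" and z: "norm z \<le> 1" "1 - \<delta> \<le> f z"
  shows "norm (x - z) \<le> \<epsilon> + 2 * \<delta> / s"
proof (rule norm_le_if_functionals_le)
  fix g :: "'a \<Rightarrow>\<^sub>L real" assume g: "norm g = 1"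
  have apply_le: "T v \<le> norm T" if "norm v \<le> 1" for T :: "'a \<Rightarrow>\<^sub>L real" and v
    using norm_blinfun[of T v] that mult_left_le[of "norm v" "norm T"] by simp
  have "f x + s * g x + (f z - s * g z) \<le> norm (f + s *\<^sub>R g) + norm (f - s *\<^sub>R g)"
    using apply_le[OF x(1), of "f + s *\<^sub>R g"] apply_le[OF z(1), of "f - s *\<^sub>R g"]
    by (simp add: blinfun.add_left blinfun.diff_left blinfun.scaleR_left)
  also have "\<dots> \<le> 2 + \<epsilon> * s"
    using smooth[of "s *\<^sub>R g"] g \<open>s > 0\<close> by simp
  finally have "s * (g x - g z) \<le> \<epsilon> * s + 2 * \<delta>"
    using x z by (simp add: algebra_simps)
  then show "g (x - z) \<le> \<epsilon> + 2 * \<delta> / s"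
    using \<open>s > 0\<close> by (simp add: blinfun.diff_right field_simps)
qed (use assms in simp)

text \<open>
  The vector \<open>a y + k\<close> is a convex combination of \<open>y + k\<close> and \<open>k\<close>, and the smallness of \<open>k\<close> makes
  \<open>y + k\<close> at least as long as \<open>k\<close>.
\<close>
lemma norm_scaleR_add_le:
  fixes y k :: "'a::real_normed_vector"
  assumes "norm y = 1" "norm k \<le> 1 / 2" "0 \<le> a" "a \<le> 1"
  shows "norm (a *\<^sub>R y + k) \<le> norm (y + k)"
proof -
  have "norm k \<le> norm (y + k)"
    using norm_diff_triangle_ineq[of y 0 "- k" 0] norm_triangle_ineq4[of "y + k" k] assms by simp
  have "a *\<^sub>R y + k = a *\<^sub>R (y + k) + (1 - a) *\<^sub>R k"
    by (simp add: algebra_simps)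
  then have "norm (a *\<^sub>R y + k) \<le> a * norm (y + k) + (1 - a) * norm k"
    using norm_triangle_ineq[of "a *\<^sub>R (y + k)" "(1 - a) *\<^sub>R k"] assms by simp
  also have "\<dots> \<le> a * norm (y + k) + (1 - a) * norm (y + k)"
    using \<open>norm k \<le> norm (y + k)\<close> assms by (intro add_left_mono mult_left_mono) auto
  finally show ?thesis by (simp add: algebra_simps)
qed

text \<open>
  A vector that almost norms a small perturbation of \<open>f \<otimes> y\<close> must almost norm \<open>f\<close>; changing its
  sign if necessary puts it into the slice where \<open>f\<close> is close to 1.
\<close>
lemma rank_one_perturbation_approx:
  fixes f :: "'a::real_normed_vector \<Rightarrow>\<^sub>L real"
    and h :: "'a \<Rightarrow>\<^sub>L 'b::real_normed_vector"
  assumes "norm f = 1" "norm y = 1" "0 < \<tau>" "norm h + \<tau> < 1"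
  obtains x where "norm x = 1" "1 - 2 * norm h - \<tau> \<le> f x" "0 \<le> f x" "f x \<le> 1"
    "norm (rank_one f y + h) \<le> norm (f x *\<^sub>R y + h x) + \<tau>"
proof -
  have lower: "1 - norm h \<le> norm (rank_one f y + h)"
    using norm_triangle_ineq4[of "rank_one f y + h" h] assms by simp
  obtain z where z: "norm z = 1" "norm (rank_one f y + h) - \<tau> < norm ((rank_one f y + h) z)"
    using blinfun_norm_approx[of "norm (rank_one f y + h) - \<tau>" "rank_one f y + h"] lower assms
    by auto
  define x where "x = (if f z \<ge> 0 then z else - z)"
  have x: "norm x = 1" "0 \<le> f x" "norm (rank_one f y + h) - \<tau> < norm ((rank_one f y + h) x)"
    using z by (auto simp: x_def blinfun.minus_right)
  have eq: "(rank_one f y + h) x = f x *\<^sub>R y + h x"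
    by (simp add: blinfun.add_left)
  have "norm (f x *\<^sub>R y + h x) \<le> f x + norm h"
    using norm_triangle_ineq[of "f x *\<^sub>R y" "h x"] norm_blinfun[of h x] x assms by simp
  then have "1 - 2 * norm h - \<tau> \<le> f x"
    using x(3) lower unfolding eq by linarith
  moreover have "f x \<le> 1"
    using norm_blinfun[of f x] x assms by simp
  moreover have "norm (rank_one f y + h) \<le> norm (f x *\<^sub>R y + h x) + \<tau>"
    using x(3) unfolding eq by linarith
  ultimately show thesis
    using that x(1,2) by blast
qed

lemma non_rough_operators:
  fixes H :: "('a::real_normed_vector \<Rightarrow>\<^sub>L 'b::real_normed_vector) set"
  assumes H: "subspace H" and rank_one: "\<And>f y. rank_one f y \<in> H"
    and domain: "\<not> rough_norm (UNIV :: ('a \<Rightarrow>\<^sub>L real) set)"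
    and codomain: "\<not> rough_norm (UNIV :: 'b set)"
  shows "\<not> rough_norm H"
proof
  assume "rough_norm H"
  then obtain \<epsilon> where \<epsilon>: "\<epsilon> > 0" and rough: "\<And>u s. u \<in> H \<Longrightarrow> norm u = 1 \<Longrightarrow> s > 0 \<Longrightarrow>
       \<exists>h\<in>H. norm h = s \<and> norm (u + h) + norm (u - h) \<ge> 2 + \<epsilon> * s"
    unfolding rough_norm_iff[OF H] by blast
  have \<epsilon>4: "\<epsilon> / 4 > 0"
    using \<epsilon> by simp
  obtain f :: "'a \<Rightarrow>\<^sub>L real" and r where f: "norm f = 1" "r > 0"
    and f_smooth: "\<And>g. norm g \<le> r \<Longrightarrow> norm (f + g) + norm (f - g) \<le> 2 + \<epsilon> / 4 * norm g"
    by (rule non_rough_normE[OF subspace_UNIV domain \<epsilon>4]) auto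
  obtain y :: 'b and q where y: "norm y = 1" "q > 0"
    and y_smooth: "\<And>k. norm k \<le> q \<Longrightarrow> norm (y + k) + norm (y - k) \<le> 2 + \<epsilon> / 4 * norm k"
    by (rule non_rough_normE[OF subspace_UNIV codomain \<epsilon>4]) auto
  \<comment> \<open>\<open>\<delta>\<close> makes the slices of depth \<open>\<delta>\<close> have diameter at most \<open>\<epsilon> / 4 + \<epsilon> / 8\<close>\<close>
  define \<delta> where "\<delta> = \<epsilon> * r / 16"
  \<comment> \<open>The last three bounds give \<open>\<tau> \<le> 1 / 4\<close> and \<open>2 * s + \<tau> \<le> \<delta>\<close> for \<open>\<tau>\<close> as below.\<close>
  define s where "s = Min {q, 1 / 4, 2 / \<epsilon>, \<delta> / 4, 2 * \<delta> / \<epsilon>}"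
  have \<delta>: "\<delta> > 0"
    using \<epsilon> f by (simp add: \<delta>_def)
  have s: "s > 0" "s \<le> q" "s \<le> 1 / 4" "s \<le> 2 / \<epsilon>" "s \<le> \<delta> / 4" "s \<le> 2 * \<delta> / \<epsilon>"
    using \<epsilon> \<delta> y by (auto simp: s_def)
  \<comment> \<open>The total cost is \<open>\<epsilon> * s\<close> times \<open>1 / 4\<close> (roughness at \<open>y\<close>) plus \<open>3 / 8\<close> (slice) plus
    twice \<open>1 / 8\<close> (the errors \<open>\<tau>\<close>), which is less than \<open>\<epsilon> * s\<close>.\<close>
  define \<tau> where "\<tau> = \<epsilon> * s / 8"
  have \<tau>: "\<tau> > 0" "\<tau> \<le> 1 / 4" "2 * s + \<tau> \<le> \<delta>"
    using s \<epsilon> by (auto simp: \<tau>_def field_simps)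
  obtain h where "h \<in> H" and h: "norm h = s"
    and ge: "norm (rank_one f y + h) + norm (rank_one f y - h) \<ge> 2 + \<epsilon> * s"
    using rough[of "rank_one f y" s] rank_one f y s by auto
  obtain x where x: "norm x = 1" "1 - 2 * s - \<tau> \<le> f x" "0 \<le> f x" "f x \<le> 1"
    "norm (rank_one f y + h) \<le> norm (f x *\<^sub>R y + h x) + \<tau>"
    using rank_one_perturbation_approx[of f y \<tau> h] f y \<tau> s h by auto
  obtain z where z: "norm z = 1" "1 - 2 * s - \<tau> \<le> f z" "0 \<le> f z" "f z \<le> 1"
    "norm (rank_one f y - h) \<le> norm (f z *\<^sub>R y - h z) + \<tau>"
    using rank_one_perturbation_approx[of f y \<tau> "- h"] f y \<tau> s h by (auto simp: blinfun.minus_left)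
  define k where "k = h x"
  have k: "norm k \<le> s"
    using norm_blinfun[of h x] x h by (simp add: k_def)
  have "norm (x - z) \<le> \<epsilon> / 4 + 2 * \<delta> / r"
    by (rule slice_diameter_le[OF f_smooth f(2)]) (use \<epsilon> \<delta> x z \<tau> in auto)
  then have xz: "norm (x - z) \<le> 3 / 8 * \<epsilon>"
    using f(2) by (simp add: \<delta>_def field_simps)
  have "norm (h (x - z)) \<le> s * norm (x - z)"
    using norm_blinfun[of h "x - z"] h by simp
  also have "\<dots> \<le> s * (3 / 8 * \<epsilon>)"
    using xz s by (intro mult_left_mono) auto
  finally have "norm (h (x - z)) \<le> s * (3 / 8 * \<epsilon>)" .
  moreover have "norm (f z *\<^sub>R y - h z) \<le> norm (f z *\<^sub>R y - k) + norm (h (x - z))"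
    using norm_triangle_ineq[of "f z *\<^sub>R y - k" "h (x - z)"] by (simp add: k_def blinfun.diff_right)
  moreover have "norm (f x *\<^sub>R y + k) \<le> norm (y + k)" "norm (f z *\<^sub>R y - k) \<le> norm (y - k)"
    using norm_scaleR_add_le[of y k "f x"] norm_scaleR_add_le[of y "- k" "f z"] x z y k s by auto
  moreover have "norm (y + k) + norm (y - k) \<le> 2 + \<epsilon> / 4 * s"
  proof -
    have "\<epsilon> / 4 * norm k \<le> \<epsilon> / 4 * s"
      using k \<epsilon> by (intro mult_left_mono) auto
    then show ?thesis
      using y_smooth[of k] k s by linarith
  qed
  ultimately have "norm (rank_one f y + h) + norm (rank_one f y - h) \<le> 2 + 7 / 8 * (\<epsilon> * s)"
    using x(5) z(5) unfolding k_def[symmetric] \<tau>_def by (simp add: algebra_simps)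
  moreover have "\<epsilon> * s > 0"
    using \<epsilon> s by simp
  ultimately show False
    using ge by linarith
qed

theorem corollary2p7:
  fixes H :: "('a::banach \<Rightarrow>\<^sub>L 'b::banach) set"
  assumes "subspace H" and "closed H"
    and "dual_tensor \<subseteq> H"
  shows "\<not> rough_norm H \<longleftrightarrow>
    \<not> rough_norm (UNIV :: ('a \<Rightarrow>\<^sub>L real) set) \<and> \<not> rough_norm (UNIV :: 'b set)"
proof -
  have "rank_one f y \<in> H" for f y
    using assms(3) unfolding dual_tensor_def by (blast intro: span_base)
  then show ?thesis
    using rough_operators_if_rough_codomain[OF assms(1)]
      rough_operators_if_rough_dual_domain[OF assms(1)] non_rough_operators[OF assms(1)]
    by blast
qed

end
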